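(* For all $\delta\in[0,1]$, $$H_2(\delta)=\frac{1+\delta}{2}.$$
   Context: Instance: firms $F=\{1,\dots,m\}$, workers $W=\{1,\dots,n\}$ ($n$ arbitrary), values $A=(a_{ij})$ with $a_{ij}\ge 0$, additive: $V_i(T)=\sum_{j\in T}a_{ij}$. A complete matching $X=(X_1,\dots,X_m)$ is a partition of $W$ (parts may be empty). $M_j=\max_i a_{ij}$. If some $a_{ij}>0$, $\delta(A)=\min_{a_{ij}>0}a_{ij}/M_j$; for the all-zero market $\delta(A)=1$. $X$ is EF1 if for every pair of firms $i,k$ with $X_k\neq\varnothing$ there is $g\in X_k$ with $V_i(X_i)\ge V_i(X_k\setminus\{g\})$. Core: profits $x_i\ge 0$ and wages $y_j\ge 0$ satisfy local financing if $x_i+\sum_{j\in X_i}y_j=V_i(X_i)$ for all $i$. $(X,x,y)$ is in the $\alpha$-core if $\sum_{i\in I}x_i+\sum_{j\in T}y_j\ge\alpha\sum_{j\in T}\max_{i\in I}a_{ij}$ for all nonempty $I\subseteq F$ and all $T\subseteq W$. $\alpha(X)$ is the largest $\alpha$ (supremum in $[0,+\infty]$) for which some nonnegative $x,y$ satisfying local financing make $(X,x,y)$ an element of the $\alpha$-core. Frontier: $H_m(\delta)=\inf\ \max_{X\text{ EF1}}\alpha(X)$, where the infimum is over all instances $A$ with $m$ firms and $\delta(A)\ge\delta$, and the maximum is over all EF1 complete matchings $X$ of the instance. Here $m=2$. *)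

theory Defs
  imports Complex_Main "HOL-Library.Extended_Nonnegative_Real"
begin

text \<open>
  A market with \<open>m\<close> firms and \<open>n\<close> workers is a matrix \<open>a\<close>, of which only the entries
  \<open>a i j\<close> with \<open>i \<in> firms m\<close> and \<open>j \<in> workers n\<close> matter.
\<close>

definition firms :: "nat \<Rightarrow> nat set" where
  "firms m = {1..m}"

definition workers :: "nat \<Rightarrow> nat set" where
  "workers n = {1..n}"

definition market :: "nat \<Rightarrow> nat \<Rightarrow> (nat \<Rightarrow> nat \<Rightarrow> real) \<Rightarrow> bool" where
  "market m n a \<longleftrightarrow> (\<forall>i\<in>firms m. \<forall>j\<in>workers n. 0 \<le> a i j)"

definition val :: "(nat \<Rightarrow> nat \<Rightarrow> real) \<Rightarrow> nat \<Rightarrow> nat set \<Rightarrow> real" where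
  "val a i T = (\<Sum>j\<in>T. a i j)"

definition best :: "(nat \<Rightarrow> nat \<Rightarrow> real) \<Rightarrow> nat set \<Rightarrow> nat \<Rightarrow> real" where
  "best a I j = Max ((\<lambda>i. a i j) ` I)"

definition delta :: "nat \<Rightarrow> nat \<Rightarrow> (nat \<Rightarrow> nat \<Rightarrow> real) \<Rightarrow> real" where
  "delta m n a =
    (if \<exists>i\<in>firms m. \<exists>j\<in>workers n. 0 < a i j
     then Min {a i j / best a (firms m) j | i j. i \<in> firms m \<and> j \<in> workers n \<and> 0 < a i j}
     else 1)"

text \<open>
  The last conjunct makes \<open>X\<close> represent exactly the tuple of its parts, so that there are
  only finitely many complete matchings.
\<close>

definition complete_matching :: "nat \<Rightarrow> nat \<Rightarrow> (nat \<Rightarrow> nat set) \<Rightarrow> bool" where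
  "complete_matching m n X \<longleftrightarrow>
     (\<Union>i\<in>firms m. X i) = workers n \<and>
     (\<forall>i\<in>firms m. \<forall>k\<in>firms m. i \<noteq> k \<longrightarrow> X i \<inter> X k = {}) \<and>
     (\<forall>i. i \<notin> firms m \<longrightarrow> X i = {})"

definition EF1 :: "nat \<Rightarrow> (nat \<Rightarrow> nat \<Rightarrow> real) \<Rightarrow> (nat \<Rightarrow> nat set) \<Rightarrow> bool" where
  "EF1 m a X \<longleftrightarrow>
     (\<forall>i\<in>firms m. \<forall>k\<in>firms m. X k \<noteq> {} \<longrightarrow>
        (\<exists>g\<in>X k. val a i (X i) \<ge> val a i (X k - {g})))"

definition local_financing ::
    "nat \<Rightarrow> (nat \<Rightarrow> nat \<Rightarrow> real) \<Rightarrow> (nat \<Rightarrow> nat set) \<Rightarrow> (nat \<Rightarrow> real) \<Rightarrow> (nat \<Rightarrow> real) \<Rightarrow> bool" where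
  "local_financing m a X x y \<longleftrightarrow>
     (\<forall>i\<in>firms m. x i + (\<Sum>j\<in>X i. y j) = val a i (X i))"

definition alpha_core ::
    "nat \<Rightarrow> nat \<Rightarrow> (nat \<Rightarrow> nat \<Rightarrow> real) \<Rightarrow> real \<Rightarrow>
     ((nat \<Rightarrow> nat set) \<times> (nat \<Rightarrow> real) \<times> (nat \<Rightarrow> real)) set" where
  "alpha_core m n a \<alpha> =
     {(X, x, y).
        complete_matching m n X \<and>
        (\<forall>i\<in>firms m. 0 \<le> x i) \<and> (\<forall>j\<in>workers n. 0 \<le> y j) \<and>
        local_financing m a X x y \<and>
        (\<forall>I T. I \<subseteq> firms m \<and> I \<noteq> {} \<and> T \<subseteq> workers n \<longrightarrow>
           (\<Sum>i\<in>I. x i) + (\<Sum>j\<in>T. y j) \<ge> \<alpha> * (\<Sum>j\<in>T. best a I j))}"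

definition alpha :: "nat \<Rightarrow> nat \<Rightarrow> (nat \<Rightarrow> nat \<Rightarrow> real) \<Rightarrow> (nat \<Rightarrow> nat set) \<Rightarrow> ennreal" where
  "alpha m n a X = Sup {ennreal \<alpha> | \<alpha>. 0 \<le> \<alpha> \<and> (\<exists>x y. (X, x, y) \<in> alpha_core m n a \<alpha>)}"

definition frontier_H :: "nat \<Rightarrow> real \<Rightarrow> ennreal" where
  "frontier_H m \<delta> =
     (INF (n, a) \<in> {(n, a). market m n a \<and> \<delta> \<le> delta m n a}.
        Max (alpha m n a ` {X. complete_matching m n X \<and> EF1 m a X}))"

lemma finite_complete_matchings: "finite {X. complete_matching m n X}"
proof (rule finite_subset)
  show "{X. complete_matching m n X} \<subseteq>
      {X. X ` firms m \<subseteq> Pow (workers n) \<and> (\<forall>i. i \<notin> firms m \<longrightarrow> X i = {})}"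
    unfolding complete_matching_def by blast
  have "{X. X ` firms m \<subseteq> Pow (workers n) \<and> (\<forall>i. i \<notin> firms m \<longrightarrow> X i = {})} =
      {X. \<forall>i. (i \<in> firms m \<longrightarrow> X i \<in> Pow (workers n)) \<and> (i \<notin> firms m \<longrightarrow> X i = {})}"
    by blast
  then show "finite {X. X ` firms m \<subseteq> Pow (workers n) \<and> (\<forall>i. i \<notin> firms m \<longrightarrow> X i = {})}"
    by (simp only:) (rule finite_set_of_finite_funs, simp_all add: firms_def workers_def)
qed

end

theory Submission imports Defs begin

text \<open>
  Upper bound: if firm 1 values two workers at 1 and firm 2 values them at \<open>\<epsilon>\<close>, EF1 forces each
  firm to hire one of them, and the welfare ratio is \<open>(1 + \<epsilon>) / 2\<close>.

  Lower bound: start from an efficient matching. If it is not EF1, exactly one firm, say firm 2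
  with valuation \<open>v\<close>, envies the other one, say firm 1 with valuation \<open>u\<close>. Move workers from
  firm 1 to firm 2 in increasing order of \<open>u/v\<close> until the envy is gone; this keeps firm 1 EF1,
  because its envy disappears after removing the last worker moved. Let \<open>L\<close> be the workers that
  firm 1 keeps and \<open>K\<close> those that moved. If the move is too costly, exchange the roles of \<open>L\<close> and
  \<open>K\<close>, which is then EF1 as well. In either case the value to firm 1 of the misplaced workers
  \<open>Q\<close> is at most that of the efficiently placed ones. Pay each efficiently placed worker
  \<open>\<alpha>\<close> times the best value, and each worker of \<open>Q\<close> between \<open>\<alpha> v\<close> and \<open>\<alpha> u\<close>; the remaining deficit
  on \<open>Q\<close> is covered by the profit of firm 1.
\<close>

section \<open>Fairness and core conditions for two bundles\<close>

definition envy_free1 :: "(nat \<Rightarrow> real) \<Rightarrow> nat set \<Rightarrow> nat set \<Rightarrow> bool" where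
  "envy_free1 u A B \<longleftrightarrow> (B \<noteq> {} \<longrightarrow> (\<exists>g\<in>B. sum u (B - {g}) \<le> sum u A))"

text \<open>\<open>p\<close> and \<open>q\<close> are the profits of the two firms, \<open>y\<close>
  the wages. The three inequalities are the core constraints of the firm sets {1}, {2} and
  {1,2}.\<close>

definition core_pair ::
    "real \<Rightarrow> (nat \<Rightarrow> real) \<Rightarrow> (nat \<Rightarrow> real) \<Rightarrow> nat set \<Rightarrow> nat set \<Rightarrow> bool" where
  "core_pair \<alpha> u v A B \<longleftrightarrow>
     (\<exists>p q y. 0 \<le> p \<and> 0 \<le> q \<and> (\<forall>j\<in>A \<union> B. 0 \<le> y j) \<and>
        p + sum y A = sum u A \<and> q + sum y B = sum v B \<and>
        (\<forall>T\<subseteq>A \<union> B. \<alpha> * sum u T \<le> p + sum y T \<and> \<alpha> * sum v T \<le> q + sum y T \<and>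
           \<alpha> * (\<Sum>j\<in>T. max (u j) (v j)) \<le> p + q + sum y T))"

lemma envy_free1_I: "g \<in> B \<Longrightarrow> sum u (B - {g}) \<le> sum u A \<Longrightarrow> envy_free1 u A B"
  unfolding envy_free1_def by blast

lemma envy_free1_if_le:
  assumes "finite B" "\<And>j. j \<in> B \<Longrightarrow> 0 \<le> u j" "sum u B \<le> sum u A"
  shows "envy_free1 u A B"
  unfolding envy_free1_def
proof
  assume "B \<noteq> {}"
  then obtain g where "g \<in> B" by blast
  moreover have "sum u (B - {g}) \<le> sum u B"
    using assms by (intro sum_mono2) auto
  ultimately show "\<exists>g\<in>B. sum u (B - {g}) \<le> sum u A" using assms(3) by force
qed

section \<open>Payoffs when one firm holds misplaced workers\<close>

lemma split_fraction:
  fixes A B E :: real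
  assumes "0 \<le> A" "0 \<le> B" "E \<le> A + B"
  obtains t where "0 \<le> t" "t \<le> 1" "t * E \<le> A" "(1 - t) * E \<le> B"
proof (cases "E \<le> A")
  case True
  then show ?thesis using that[of 1] assms by simp
next
  case False
  then have "0 < E" using assms by simp
  then have "(1 - A / E) * E = E - A" by (simp add: field_simps)
  then show ?thesis using that[of "A / E"] assms False \<open>0 < E\<close> by simp
qed

text \<open>Firm 2 holds the workers \<open>Q\<close>, which firm 1 values at least as much. The
  surplus (1-\<alpha>)(v(S)+v(Q)) of firm 2 and the profit (1-\<alpha>)u(P) of firm 1 together have
  to cover the gap \<alpha>(u(Q)-v(Q)). Adding 1-\<alpha> times \<open>le\<close> to \<delta>u(Q)
  \<le> v(Q) gives exactly this, because (1-\<alpha>)+\<delta> = \<alpha>; hence the value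
  (1+\<delta>)/2.\<close>

lemma core_pairI:
  fixes \<delta> :: real
  assumes \<delta>: "0 \<le> \<delta>" "\<delta> \<le> 1"
    and fin: "finite P" "finite Q" "finite S"
    and disj: "P \<inter> Q = {}" "P \<inter> S = {}" "Q \<inter> S = {}"
    and P: "\<And>j. j \<in> P \<Longrightarrow> 0 \<le> v j \<and> v j \<le> u j"
    and Q: "\<And>j. j \<in> Q \<Longrightarrow> 0 \<le> v j \<and> v j \<le> u j \<and> \<delta> * u j \<le> v j"
    and S: "\<And>j. j \<in> S \<Longrightarrow> 0 \<le> u j \<and> u j \<le> v j"
    and le: "sum u Q \<le> sum u P + sum v S"
  shows "core_pair ((1 + \<delta>) / 2) u v P (S \<union> Q)"
proof -
  define \<alpha> where "\<alpha> = (1 + \<delta>) / 2"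
  have \<alpha>: "0 \<le> \<alpha>" "\<alpha> \<le> 1" "\<delta> = 2 * \<alpha> - 1" using \<delta> by (auto simp: \<alpha>_def field_simps)
  have pos: "0 \<le> sum v S" "0 \<le> sum v Q" "0 \<le> sum u P"
    using P Q S by (force intro: sum_nonneg)+
  have "\<delta> * sum u Q \<le> sum v Q"
    unfolding sum_distrib_left using Q by (intro sum_mono) auto
  moreover have "(1 - \<alpha>) * sum u Q \<le> (1 - \<alpha>) * (sum u P + sum v S)"
    using le \<alpha> by (intro mult_left_mono) auto
  ultimately have "\<alpha> * (sum u Q - sum v Q) \<le> (1 - \<alpha>) * (sum v S + sum v Q) + (1 - \<alpha>) * sum u P"
    by (simp add: \<alpha>(3) algebra_simps)
  moreover have "0 \<le> (1 - \<alpha>) * (sum v S + sum v Q)" "0 \<le> (1 - \<alpha>) * sum u P"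
    using pos \<alpha> by auto
  \<comment> \<open>\<open>t\<close> is the share of the gap on \<open>Q\<close> that firm 2 pays as
    wages; the share \<open>1 - t\<close> falls to the profit of firm 1.\<close>
  ultimately obtain t where t: "0 \<le> t" "t \<le> 1"
      "t * (\<alpha> * (sum u Q - sum v Q)) \<le> (1 - \<alpha>) * (sum v S + sum v Q)"
      "(1 - t) * (\<alpha> * (sum u Q - sum v Q)) \<le> (1 - \<alpha>) * sum u P"
    using split_fraction by blast
  define y where
    "y j = (if j \<in> Q then \<alpha> * (v j + t * (u j - v j)) else \<alpha> * max (u j) (v j))" for j
  \<comment> \<open>\<open>z\<close> is the shortfall of a wage against \<alpha> times the best
    value.\<close>
  define z where "z j = (if j \<in> Q then (1 - t) * (\<alpha> * (u j - v j)) else 0)" for j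
  define p where "p = (1 - \<alpha>) * sum u P"
  define q where "q = sum v (S \<union> Q) - sum y (S \<union> Q)"
  have yP: "sum y P = \<alpha> * sum u P"
    unfolding sum_distrib_left using disj P by (intro sum.cong) (auto simp: y_def max_absorb1)
  have yS: "sum y S = \<alpha> * sum v S"
    unfolding sum_distrib_left using disj S by (intro sum.cong) (auto simp: y_def max_absorb2)
  have yQ: "sum y Q = \<alpha> * (sum v Q + t * (sum u Q - sum v Q))"
    by (simp add: y_def sum_distrib_left sum.distrib sum_subtractf right_diff_distrib distrib_left)
  have zQ: "sum z Q = (1 - t) * (\<alpha> * (sum u Q - sum v Q))"
    by (simp add: z_def sum_distrib_left sum_subtractf right_diff_distrib)
  have p0: "0 \<le> p" using pos \<alpha> by (simp add: p_def)
  have "sum v (S \<union> Q) = sum v S + sum v Q" "sum y (S \<union> Q) = sum y S + sum y Q"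
    using fin disj by (auto intro: sum.union_disjoint)
  then have q0: "0 \<le> q" using t(3) by (simp add: q_def yS yQ algebra_simps)
  \<comment> \<open>Hence wages alone satisfy firm 2.\<close>
  have yv: "\<alpha> * v j \<le> y j" if "j \<in> P \<union> (S \<union> Q)" for j
    using that Q[of j] \<alpha> t by (auto simp: y_def intro!: mult_left_mono)
  have y0: "0 \<le> y j" if "j \<in> P \<union> (S \<union> Q)" for j
  proof -
    have "0 \<le> \<alpha> * v j" using that P[of j] Q[of j] S[of j] \<alpha> by auto
    then show ?thesis using yv[OF that] by simp
  qed
  have z0: "0 \<le> z j" for j
    using Q[of j] t \<alpha> by (auto simp: z_def)
  \<comment> \<open>The profit \<open>p\<close> absorbs every shortfall, so one bound settles both
    {1} and {1,2}.\<close>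
  have joint: "\<alpha> * (\<Sum>j\<in>T. max (u j) (v j)) \<le> p + sum y T" if T: "T \<subseteq> P \<union> (S \<union> Q)" for T
  proof -
    have finT: "finite T" using T fin by (meson finite_UnI finite_subset)
    have "\<alpha> * (\<Sum>j\<in>T. max (u j) (v j)) \<le> (\<Sum>j\<in>T. y j + z j)"
      unfolding sum_distrib_left
    proof (intro sum_mono)
      fix j assume "j \<in> T"
      show "\<alpha> * max (u j) (v j) \<le> y j + z j"
        using Q[of j] by (auto simp: y_def z_def max_def algebra_simps)
    qed
    also have "\<dots> = sum y T + sum z T" by (simp add: sum.distrib)
    also have "sum z T = sum z (T \<inter> Q)"
      using finT by (intro sum.mono_neutral_right) (auto simp: z_def)
    also have "sum z (T \<inter> Q) \<le> sum z Q"
      using fin z0 by (intro sum_mono2) auto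
    also have "sum z Q \<le> p" using t(4) by (simp add: zQ p_def)
    finally show ?thesis by simp
  qed
  have first: "\<alpha> * sum u T \<le> p + sum y T" if T: "T \<subseteq> P \<union> (S \<union> Q)" for T
  proof -
    have "sum u T \<le> (\<Sum>j\<in>T. max (u j) (v j))" by (intro sum_mono) auto
    then have "\<alpha> * sum u T \<le> \<alpha> * (\<Sum>j\<in>T. max (u j) (v j))"
      using \<alpha> by (intro mult_left_mono)
    then show ?thesis using joint[OF T] by simp
  qed
  have second: "\<alpha> * sum v T \<le> q + sum y T" if T: "T \<subseteq> P \<union> (S \<union> Q)" for T
  proof -
    have "\<alpha> * sum v T \<le> sum y T"
      unfolding sum_distrib_left using T yv by (intro sum_mono) auto
    then show ?thesis using q0 by simp
  qed
  have "p + sum y P = sum u P" "q + sum y (S \<union> Q) = sum v (S \<union> Q)"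
    by (simp_all add: p_def q_def yP algebra_simps)
  moreover have "\<alpha> * (\<Sum>j\<in>T. max (u j) (v j)) \<le> p + q + sum y T" if "T \<subseteq> P \<union> (S \<union> Q)" for T
    using joint[OF that] q0 by simp
  ultimately show ?thesis
    unfolding core_pair_def \<alpha>_def[symmetric]
    by (intro exI[of _ p] exI[of _ q] exI[of _ y] conjI ballI allI impI p0 q0 y0 first second)
qed

section \<open>Cutting an envied bundle by value ratio\<close>

text \<open>\<open>K\<close> moves to the owner of \<open>R\<close> first, \<open>g\<close> last,
  and \<open>L\<close> stays. Just before \<open>g\<close> moves, the envy survives any single
  removal, in particular that of \<open>g\<close>: v(R)+v(K) < v(L). The ratio of \<open>g\<close>
  separates \<open>L\<close> from \<open>R\<close> and \<open>K\<close>, so the comparison carries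
  over to \<open>u\<close>. Once \<open>g\<close> has moved, one removal from \<open>L\<close> ends
  the envy.\<close>

lemma ratio_cut:
  fixes u v :: "nat \<Rightarrow> real"
  assumes fin: "finite S"
    and S: "\<And>j. j \<in> S \<Longrightarrow> 0 < v j \<and> v j \<le> u j"
    and R: "\<And>j. j \<in> R \<Longrightarrow> 0 \<le> u j \<and> u j \<le> v j"
    and "S \<noteq> {}" and envy: "\<And>h. h \<in> S \<Longrightarrow> sum v R < sum v (S - {h})"
  obtains L K g where "S = insert g (L \<union> K)" "g \<notin> L" "g \<notin> K" "L \<inter> K = {}"
    "sum v R + sum v K < sum v L" "sum u R + sum u K \<le> sum u L"
    "\<exists>h\<in>L. sum v (L - {h}) \<le> sum v R + sum v K + v g"
proof -
  define r where "r j = u j / v j" for j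
  \<comment> \<open>A \<open>good\<close> set is what firm 1 may still hold while the transfer runs;
    taking one of least cardinality replaces an induction along the order of ratios.\<close>
  define good where "good N \<longleftrightarrow> N \<noteq> {} \<and> N \<subseteq> S \<and> (\<forall>j\<in>N. \<forall>k\<in>S - N. r k \<le> r j) \<and>
      (\<forall>h\<in>N. sum v R + sum v (S - N) < sum v (N - {h}))" for N
  have "good S" using assms by (auto simp: good_def)
  then obtain N where N: "good N" and min: "\<And>M. good M \<Longrightarrow> card N \<le> card M"
    using ex_has_least_nat[of good S card] by blast
  have finN: "finite N" and NS: "N \<subseteq> S" using N fin finite_subset by (auto simp: good_def)
  then obtain g where g: "g \<in> N" and gmin: "\<And>j. j \<in> N \<Longrightarrow> r g \<le> r j"
    using ex_min_if_finite[of "r ` N"] N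
    by (metis (no_types, lifting) arg_min_if_finite(1) arg_min_least good_def)
  define L where "L = N - {g}"
  define K where "K = S - N"
  have vR: "0 \<le> sum v R" using R by (force intro: sum_nonneg)
  have vK: "0 \<le> sum v K" using S by (force simp: K_def intro: sum_nonneg)
  have vL: "sum v R + sum v K < sum v L" using N g by (auto simp: good_def L_def K_def)
  then have L: "L \<noteq> {}" using vR vK by auto
  \<comment> \<open>This makes \<open>r g\<close> a valid threshold on \<open>R\<close> too, where u
    \<le> v.\<close>
  have c1: "1 \<le> r g" using S[of g] g NS by (auto simp: r_def field_simps)
  have "sum u R + sum u K \<le> r g * sum v R + r g * sum v K"
    unfolding sum_distrib_left
  proof (intro add_mono sum_mono)
    fix j assume "j \<in> R"
    then have "u j \<le> v j" "0 \<le> v j" using R[of j] by auto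
    then show "u j \<le> r g * v j" using mult_right_mono[OF c1, of "v j"] by simp
  next
    fix j assume j: "j \<in> K"
    then have "r j \<le> r g" using N g by (auto simp: good_def K_def)
    moreover have "0 < v j" using S j by (auto simp: K_def)
    ultimately show "u j \<le> r g * v j" by (simp add: r_def[of j] field_simps)
  qed
  also have "\<dots> \<le> r g * sum v L"
    using mult_left_mono[of "sum v R + sum v K" "sum v L" "r g"] vL c1
    by (simp add: distrib_left)
  also have "\<dots> \<le> sum u L"
    unfolding sum_distrib_left
  proof (intro sum_mono)
    fix j assume j: "j \<in> L"
    then have "r g \<le> r j" using gmin by (auto simp: L_def)
    moreover have "0 < v j" using S j NS by (auto simp: L_def)
    ultimately show "r g * v j \<le> u j" by (simp add: r_def[of j] field_simps)
  qed
  finally have uL: "sum u R + sum u K \<le> sum u L" .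
  have "card L < card N" using finN g unfolding L_def by (rule card_Diff1_less)
  \<comment> \<open>\<open>L\<close> is nonempty and still closed upwards in the ratio, so what
    fails is the persistence of envy.\<close>
  then have "\<not> good L" using min[of L] by auto
  moreover have "\<forall>j\<in>L. \<forall>k\<in>S - L. r k \<le> r j"
    using N gmin by (auto simp: good_def L_def)
  moreover have "L \<subseteq> S" using NS by (auto simp: L_def)
  ultimately have "\<exists>h\<in>L. sum v (L - {h}) \<le> sum v R + sum v (S - L)"
    using L by (auto simp: good_def not_less)
  moreover have "S - L = insert g K" using g NS by (auto simp: L_def K_def)
  moreover have "finite K" "g \<notin> K" using fin g by (auto simp: K_def)
  ultimately have h: "\<exists>h\<in>L. sum v (L - {h}) \<le> sum v R + sum v K + v g"
    by (simp add: algebra_simps)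
  show thesis
    by (rule that[of g L K, OF _ _ _ _ vL uL h]) (use g NS in \<open>auto simp: L_def K_def\<close>)
qed

section \<open>EF1 splits with core payoffs\<close>

text \<open>With \<open>G\<close> consisting of \<open>K\<close> and \<open>g\<close>, firm 1 keeps
  either \<open>L\<close> or \<open>G\<close>, and always \<open>Z\<close>. Either way firm 2 is EF1
  by \<open>ratio_cut\<close>. The bound that \<open>core_pairI\<close> needs on the misplaced part
  holds for \<open>L\<close> whenever it fails for \<open>G\<close>.\<close>

lemma split_if_envy:
  fixes u v :: "nat \<Rightarrow> real"
  assumes \<delta>: "0 \<le> \<delta>" "\<delta> \<le> 1"
    and fin: "finite S" "finite R" and disj: "S \<inter> R = {}"
    and S: "\<And>j. j \<in> S \<Longrightarrow> 0 \<le> v j \<and> v j \<le> u j"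
    and R: "\<And>j. j \<in> R \<Longrightarrow> 0 \<le> u j \<and> u j \<le> v j"
    and ratio: "\<And>j. j \<in> S \<Longrightarrow> 0 < v j \<Longrightarrow> \<delta> * u j \<le> v j"
    and envy: "\<not> envy_free1 v R S"
  obtains A B where "A \<union> B = S \<union> R" "A \<inter> B = {}" "envy_free1 u A B" "envy_free1 v B A"
    "core_pair ((1 + \<delta>) / 2) u v A B"
proof -
  \<comment> \<open>Workers of zero value to \<open>v\<close> stay with firm 1: u/v is meaningless
    for them and \<open>ratio\<close> does not cover them, while firm 2 does not notice
    them.\<close>
  define Z where "Z = {j \<in> S. v j = 0}"
  define S' where "S' = {j \<in> S. 0 < v j}"
  have SZ: "S = S' \<union> Z" "S' \<inter> Z = {}" using S by (force simp: Z_def S'_def)+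
  have finS': "finite S'" and finZ: "finite Z" using fin by (auto simp: S'_def Z_def)
  have dropZ: "sum v (C - {h}) = sum v (C - Z - {h})" if "finite C" for C h
    using that by (intro sum.mono_neutral_right) (auto simp: Z_def)
  have env: "S \<noteq> {}" "\<And>h. h \<in> S \<Longrightarrow> sum v R < sum v (S - {h})"
    using envy by (auto simp: envy_free1_def not_le)
  have vR: "0 \<le> sum v R" using R by (force intro: sum_nonneg)
  have S'Z: "S - Z = S'" using SZ by blast
  have env': "sum v R < sum v (S' - {h})" if "h \<in> S'" for h
    using env(2)[of h] that dropZ[OF fin(1), of h] S'Z SZ(1) by simp
  have S': "0 < v j \<and> v j \<le> u j" if "j \<in> S'" for j
    using that S by (auto simp: S'_def)
  have "S' \<noteq> {}"
  proof
    assume "S' = {}"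
    then have "sum v (S - {h}) = 0" for h using dropZ[OF fin(1), of h] S'Z by simp
    then show False using env vR by force
  qed
  obtain L K g where LK: "S' = insert g (L \<union> K)" "g \<notin> L" "g \<notin> K" "L \<inter> K = {}"
    "sum v R + sum v K < sum v L" "sum u R + sum u K \<le> sum u L"
    "\<exists>h\<in>L. sum v (L - {h}) \<le> sum v R + sum v K + v g"
    by (rule ratio_cut[OF finS' S' R \<open>S' \<noteq> {}\<close> env'])
  define G where "G = insert g K"
  have G: "S' = L \<union> G" "L \<inter> G = {}" "g \<in> G" "G - {g} = K" using LK(1-4) by (auto simp: G_def)
  have finLG: "finite L" "finite G" "finite K" using finS' LK(1) by (auto simp: G_def)
  have inS: "L \<subseteq> S" "G \<subseteq> S" "Z \<subseteq> S" using G SZ(1) by auto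
  have notZ: "L \<inter> Z = {}" "G \<inter> Z = {}" using G SZ(2) by auto
  have notR: "L \<inter> R = {}" "G \<inter> R = {}" "Z \<inter> R = {}" using inS disj by auto
  have uZ: "0 \<le> sum u Z" using S inS(3) by (force intro: sum_nonneg)
  have u0: "0 \<le> u j" if "j \<in> S \<union> R" for j using that S R by force
  have Q: "0 \<le> v j \<and> v j \<le> u j \<and> \<delta> * u j \<le> v j" if "j \<in> L \<union> G" for j
    using that S ratio G(1) by (auto simp: S'_def)
  have sumG: "sum f G = f g + sum f K" for f :: "nat \<Rightarrow> real"
    using LK(3) finLG(3) by (simp add: G_def)
  have sums: "sum f (L \<union> Z) = sum f L + sum f Z" "sum f (G \<union> Z) = sum f G + sum f Z"
     "sum f (R \<union> G) = sum f R + sum f G" "sum f (R \<union> L) = sum f R + sum f L"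
     "sum f (R \<union> K) = sum f R + sum f K"
    for f :: "nat \<Rightarrow> real"
    by (rule sum.union_disjoint; use finLG finZ fin notZ notR G(4) in blast)+
  show thesis
  proof (cases "sum u G \<le> sum u L + sum u Z + sum v R")
    case True
    show thesis
    proof (rule that[of "L \<union> Z" "R \<union> G"])
      show "(L \<union> Z) \<union> (R \<union> G) = S \<union> R" using SZ G(1) by auto
      show "(L \<union> Z) \<inter> (R \<union> G) = {}" using G(2) notZ notR by auto
      have "(R \<union> G) - {g} = R \<union> K" using G notR by auto
      then show "envy_free1 u (L \<union> Z) (R \<union> G)"
        using LK(6) uZ G(3) by (intro envy_free1_I[of g]) (simp_all add: sums)
      obtain h where h: "h \<in> L" "sum v (L - {h}) \<le> sum v R + sum v K + v g" using LK(7) by blast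
      have "L \<union> Z - Z = L" using notZ by auto
      then have "sum v (L \<union> Z - {h}) = sum v (L - {h})"
        using dropZ[of "L \<union> Z" h] finLG finZ by simp
      then show "envy_free1 v (R \<union> G) (L \<union> Z)"
        using h by (intro envy_free1_I[of h]) (simp_all add: sums sumG)
      show "core_pair ((1 + \<delta>) / 2) u v (L \<union> Z) (R \<union> G)"
      proof (rule core_pairI[OF \<delta>])
        show "sum u G \<le> sum u (L \<union> Z) + sum v R" using True by (simp add: sums)
      qed (use finLG finZ fin G(2) notZ notR inS S R Q in blast)+
    qed
  next
    case False
    show thesis
    proof (rule that[of "G \<union> Z" "R \<union> L"])
      show "(G \<union> Z) \<union> (R \<union> L) = S \<union> R" using SZ G(1) by auto
      show "(G \<union> Z) \<inter> (R \<union> L) = {}" using G(2) notZ notR by auto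
      \<comment> \<open>With this, failure of the case condition means that firm 1 does not envy at
        all after the exchange.\<close>
      have uv: "sum u R \<le> sum v R" using R by (intro sum_mono) auto
      show "envy_free1 u (G \<union> Z) (R \<union> L)"
      proof (rule envy_free1_if_le)
        show "sum u (R \<union> L) \<le> sum u (G \<union> Z)" using False uv uZ by (simp add: sums)
      qed (use finLG fin u0 inS in auto)
      have "G \<union> Z - Z - {g} = K" using notZ G(4) by auto
      then have "sum v (G \<union> Z - {g}) = sum v K"
        using dropZ[of "G \<union> Z" g] finLG finZ by simp
      then show "envy_free1 v (R \<union> L) (G \<union> Z)"
        using LK(5) vR G(3) by (intro envy_free1_I[of g]) (simp_all add: sums)
      show "core_pair ((1 + \<delta>) / 2) u v (G \<union> Z) (R \<union> L)"
      proof (rule core_pairI[OF \<delta>])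
        show "sum u L \<le> sum u (G \<union> Z) + sum v R" using False vR uZ by (simp add: sums)
      qed (use finLG finZ fin G(2) notZ notR inS S R Q in blast)+
    qed
  qed
qed

lemma core_pair_commute:
  assumes "core_pair \<alpha> u v A B"
  shows "core_pair \<alpha> v u B A"
proof -
  obtain p q y where "0 \<le> p" "0 \<le> q" "\<forall>j\<in>A \<union> B. 0 \<le> y j"
      "p + sum y A = sum u A" "q + sum y B = sum v B"
      "\<And>T. T \<subseteq> A \<union> B \<Longrightarrow> \<alpha> * sum u T \<le> p + sum y T \<and> \<alpha> * sum v T \<le> q + sum y T \<and>
         \<alpha> * (\<Sum>j\<in>T. max (u j) (v j)) \<le> p + q + sum y T"
    using assms unfolding core_pair_def by blast
  moreover have "B \<union> A = A \<union> B" "max (v j) (u j) = max (u j) (v j)" for j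
    by (auto simp: max.commute)
  ultimately show ?thesis
    unfolding core_pair_def
    by (rule_tac x = q in exI, rule_tac x = p in exI, rule_tac x = y in exI) (simp add: add.commute[of q])
qed

text \<open>\<open>S\<close> and \<open>R\<close> form an efficient matching, ties going to the
  first firm. It serves as it is or is repaired by \<open>split_if_envy\<close>, with the roles of
  the firms exchanged if the first one envies.\<close>

lemma split_exists:
  fixes u v :: "nat \<Rightarrow> real"
  assumes \<delta>: "0 \<le> \<delta>" "\<delta> \<le> 1" and fin: "finite W"
    and nonneg: "\<And>j. j \<in> W \<Longrightarrow> 0 \<le> u j \<and> 0 \<le> v j"
    and uv: "\<And>j. j \<in> W \<Longrightarrow> 0 < v j \<Longrightarrow> \<delta> * u j \<le> v j"
    and vu: "\<And>j. j \<in> W \<Longrightarrow> 0 < u j \<Longrightarrow> \<delta> * v j \<le> u j"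
  obtains A B where "A \<union> B = W" "A \<inter> B = {}" "envy_free1 u A B" "envy_free1 v B A"
    "core_pair ((1 + \<delta>) / 2) u v A B"
proof -
  define S where "S = {j \<in> W. v j \<le> u j}"
  define R where "R = {j \<in> W. u j < v j}"
  have SR: "S \<union> R = W" "S \<inter> R = {}" "finite S" "finite R" using fin by (auto simp: S_def R_def)
  consider "\<not> envy_free1 v R S" | "\<not> envy_free1 u S R" | "envy_free1 v R S" "envy_free1 u S R"
    by blast
  then show thesis
  proof cases
    case 1
    show thesis
      by (rule split_if_envy[OF \<delta> SR(3,4,2) _ _ _ 1, of u])
        (use nonneg uv SR(1) that in \<open>auto simp: S_def R_def\<close>)
  next
    case 2
    have RS: "R \<inter> S = {}" using SR by blast
    obtain B A where BA: "B \<union> A = R \<union> S" "B \<inter> A = {}" "envy_free1 v B A" "envy_free1 u A B"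
        "core_pair ((1 + \<delta>) / 2) v u B A"
      by (rule split_if_envy[OF \<delta> SR(4,3) RS _ _ _ 2, of v])
        (use nonneg vu in \<open>auto simp: S_def R_def\<close>)
    then show thesis
      using that[of A B] core_pair_commute[of _ v u B A] SR(1) by (simp add: Un_commute Int_commute)
  next
    case 3
    have "0 \<le> sum u S" "0 \<le> sum v R" using nonneg by (auto simp: S_def R_def intro: sum_nonneg)
    \<comment> \<open>Nobody is misplaced, so the set \<open>Q\<close> of \<open>core_pairI\<close>
      is empty.\<close>
    then have "core_pair ((1 + \<delta>) / 2) u v S (R \<union> {})"
      by (intro core_pairI) (use \<delta> SR nonneg in \<open>auto simp: S_def R_def\<close>)
    then show thesis using that[of S R] SR 3 by simp
  qed
qed

section \<open>From two bundles to markets with two firms\<close>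

declare One_nat_def [simp del]

lemma firms_2: "firms 2 = {1, 2}"
  by (auto simp: firms_def)

lemma best_2: "best a {1, 2} j = max (a 1 j) (a 2 j)" "best a {i} j = a i j"
  by (simp_all add: best_def)

lemma delta_mult_le:
  assumes "market 2 n a" "\<delta> \<le> delta 2 n a"
    and i: "i \<in> firms 2" and j: "j \<in> workers n" and "0 < a i j"
  shows "\<delta> * best a (firms 2) j \<le> a i j"
proof -
  let ?D = "{a i j / best a (firms 2) j | i j. i \<in> firms 2 \<and> j \<in> workers n \<and> 0 < a i j}"
  have "?D \<subseteq> (\<lambda>(i, j). a i j / best a (firms 2) j) ` (firms 2 \<times> workers n)" by auto
  then have "finite ?D" by (rule finite_subset) (simp add: firms_def workers_def)
  moreover have "a i j / best a (firms 2) j \<in> ?D" using assms by blast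
  ultimately have "Min ?D \<le> a i j / best a (firms 2) j" by (rule Min_le)
  moreover have "delta 2 n a = Min ?D" using assms by (auto simp: delta_def)
  ultimately have "\<delta> \<le> a i j / best a (firms 2) j" using assms(2) by simp
  moreover have "0 < best a (firms 2) j"
    using i \<open>0 < a i j\<close> by (auto simp: firms_2 best_2 max_def)
  ultimately show ?thesis by (simp add: field_simps)
qed

text \<open>Besides the lower bound, this supplies the existence of an EF1 matching, without which
  the maximum in \<open>frontier_H\<close> would be over an empty set.\<close>

lemma EF1_alpha_ge:
  assumes \<delta>: "0 \<le> \<delta>" "\<delta> \<le> 1" and market: "market 2 n a" and del: "\<delta> \<le> delta 2 n a"
  obtains X where "complete_matching 2 n X" "EF1 2 a X" "ennreal ((1 + \<delta>) / 2) \<le> alpha 2 n a X"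
proof -
  have nonneg: "0 \<le> a 1 j \<and> 0 \<le> a 2 j" if "j \<in> workers n" for j
    using market that by (auto simp: market_def firms_2)
  have r: "\<delta> * a i j \<le> a k j" if "j \<in> workers n" "0 < a k j" "i \<in> {1,2}" "k \<in> {1,2}" for i j k
  proof -
    have "\<delta> * a i j \<le> \<delta> * best a (firms 2) j"
      using that \<delta> by (intro mult_left_mono) (auto simp: firms_2 best_2)
    also have "\<dots> \<le> a k j" using that delta_mult_le[OF market del, of k j] by (auto simp: firms_2)
    finally show ?thesis .
  qed
  obtain A B where AB: "A \<union> B = workers n" "A \<inter> B = {}"
      and ef: "envy_free1 (a 1) A B" "envy_free1 (a 2) B A"
      and core: "core_pair ((1 + \<delta>) / 2) (a 1) (a 2) A B"
    by (rule split_exists[OF \<delta>, of "workers n" "a 1" "a 2"])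
      (use nonneg r in \<open>auto simp: workers_def\<close>)
  define X where "X = (\<lambda>i::nat. if i = 1 then A else if i = 2 then B else {})"
  have X: "X 1 = A" "X 2 = B" by (simp_all add: X_def)
  have cm: "complete_matching 2 n X"
    using AB by (auto simp: complete_matching_def firms_2 X_def)
  have fin: "finite A" "finite B"
    using AB(1) finite_Un[of A B] by (auto simp: workers_def)
  \<comment> \<open>\<open>EF1\<close> also ranges over the pairs with i = k.\<close>
  have self: "envy_free1 (a 1) A A" "envy_free1 (a 2) B B"
    using fin nonneg AB(1) by (auto intro!: envy_free1_if_le)
  have "EF1 2 a X"
    using ef self by (auto simp: EF1_def firms_2 X val_def envy_free1_def)
  obtain p q y where pq: "0 \<le> p" "0 \<le> q" "\<forall>j\<in>A \<union> B. 0 \<le> y j"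
      "p + sum y A = sum (a 1) A" "q + sum y B = sum (a 2) B"
      and T: "\<And>T. T \<subseteq> A \<union> B \<Longrightarrow> (1 + \<delta>) / 2 * sum (a 1) T \<le> p + sum y T \<and>
         (1 + \<delta>) / 2 * sum (a 2) T \<le> q + sum y T \<and>
         (1 + \<delta>) / 2 * (\<Sum>j\<in>T. max (a 1 j) (a 2 j)) \<le> p + q + sum y T"
    using core unfolding core_pair_def by blast
  define x where "x = (\<lambda>i::nat. if i = 1 then p else q)"
  have "(X, x, y) \<in> alpha_core 2 n a ((1 + \<delta>) / 2)"
  proof -
    have "(1 + \<delta>) / 2 * (\<Sum>j\<in>T. best a I j) \<le> (\<Sum>i\<in>I. x i) + (\<Sum>j\<in>T. y j)"
      if I: "I \<subseteq> {1, 2}" "I \<noteq> {}" and "T \<subseteq> workers n" for I T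
    proof -
      consider "I = {1}" | "I = {2}" | "I = {1, 2}" using I by blast
      then show ?thesis
        using T[of T] AB(1) \<open>T \<subseteq> workers n\<close> by cases (simp_all add: best_2 x_def)
    qed
    then show ?thesis
      using cm pq AB(1)
      by (auto simp: alpha_core_def local_financing_def firms_2 X x_def val_def)
  qed
  then have "ennreal ((1 + \<delta>) / 2) \<le> alpha 2 n a X"
    unfolding alpha_def using \<delta>
    by (intro Sup_upper CollectI exI[of _ "(1 + \<delta>) / 2"]) auto
  then show thesis using that cm \<open>EF1 2 a X\<close> by blast
qed

section \<open>The instance for the upper bound\<close>

lemma frontier_H_le:
  assumes "0 < \<epsilon>" "\<epsilon> \<le> 1" "\<delta> \<le> \<epsilon>"
  shows "frontier_H 2 \<delta> \<le> ennreal ((1 + \<epsilon>) / 2)"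
proof -
  define a where "a = (\<lambda>i j::nat. if i = (1::nat) then 1 else \<epsilon>)"
  have a: "a 1 j = 1" "a 2 j = \<epsilon>" for j by (simp_all add: a_def)
  have market: "market 2 2 a" using assms by (auto simp: market_def a_def)
  have W: "workers 2 = {1, 2}" by (auto simp: workers_def)
  have best: "best a {1, 2} j = 1" for j using assms by (simp add: best_2 a)
  have "{a i j / best a (firms 2) j | i j. i \<in> firms 2 \<and> j \<in> workers 2 \<and> 0 < a i j} = {1, \<epsilon>}"
      (is "?D = _")
  proof
    show "?D \<subseteq> {1, \<epsilon>}" by (auto simp: firms_2 W best a)
    have "a i 1 / best a (firms 2) 1 \<in> ?D" if "i \<in> {1, 2}" for i
      using that assms by (intro CollectI exI[of _ i] exI[of _ 1]) (auto simp: firms_2 W a)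
    from this[of 1] this[of 2] show "{1, \<epsilon>} \<subseteq> ?D" by (simp add: a best firms_2)
  qed
  then have "delta 2 2 a = \<epsilon>"
    using assms by (simp add: delta_def firms_2 W a min_def)
  then have del: "\<epsilon> \<le> delta 2 2 a" by simp
  have upper: "alpha 2 2 a X \<le> ennreal ((1 + \<epsilon>) / 2)"
    if cm: "complete_matching 2 2 X" and ef: "EF1 2 a X" for X
    unfolding alpha_def
  proof (rule Sup_least, clarify)
    fix \<alpha> x y assume "(X, x, y) \<in> alpha_core 2 2 a \<alpha>"
    then have lf: "x 1 + sum y (X 1) = val a 1 (X 1)" "x 2 + sum y (X 2) = val a 2 (X 2)"
      and "\<forall>I T. I \<subseteq> {1, 2} \<and> I \<noteq> {} \<and> T \<subseteq> workers 2 \<longrightarrow>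
        \<alpha> * (\<Sum>j\<in>T. best a I j) \<le> sum x I + sum y T"
      by (simp_all add: alpha_core_def local_financing_def firms_2)
    \<comment> \<open>For all firms and all workers the right-hand side is, by local financing, the
      total value realised by \<open>X\<close>; the best total is 2.\<close>
    then have "\<alpha> * (\<Sum>j\<in>workers 2. best a {1, 2} j) \<le> sum x {1, 2} + sum y (workers 2)"
      by blast
    then have le: "2 * \<alpha> \<le> x 1 + x 2 + sum y (workers 2)" by (simp add: best W)
    have U: "X 1 \<union> X 2 = workers 2" "X 1 \<inter> X 2 = {}"
      using cm by (auto simp: complete_matching_def firms_2)
    have fin: "finite (X 1)" "finite (X 2)"
      using U(1) finite_Un[of "X 1" "X 2"] by (auto simp: W)
    have "sum y (workers 2) = sum y (X 1) + sum y (X 2)"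
      using U fin by (metis sum.union_disjoint)
    moreover have "val a 1 (X 1) = card (X 1)" "val a 2 (X 2) = \<epsilon> * card (X 2)"
      by (simp_all add: val_def a)
    ultimately have le': "2 * \<alpha> \<le> card (X 1) + \<epsilon> * card (X 2)" using le lf by simp
    have card: "card (X 1) + card (X 2) = 2"
      using U fin card_Un_disjoint[of "X 1" "X 2"] by (simp add: W)
    \<comment> \<open>If firm 2 had nobody, one of the two workers of firm 1 would remain after any
      removal, worth \<epsilon> > 0 to firm 2.\<close>
    have "X 2 \<noteq> {}"
    proof
      assume X2: "X 2 = {}"
      then have "X 1 \<noteq> {}" using card by auto
      then obtain g where "g \<in> X 1" "val a 2 (X 1 - {g}) \<le> val a 2 (X 2)"
        using ef by (auto simp: EF1_def firms_2)
      moreover have "card (X 1 - {g}) = 1"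
        using \<open>g \<in> X 1\<close> card X2 fin by simp
      ultimately show False using X2 assms by (simp add: val_def a)
    qed
    then have "1 \<le> card (X 2)" using fin by (metis One_nat_def Suc_leI card_gt_0_iff)
    \<comment> \<open>As \<epsilon> \<le> 1, each worker at firm 2 costs 1-\<epsilon> of the total,
      so the worst case for the bound is one worker there.\<close>
    then have "(1 - \<epsilon>) * 1 \<le> (1 - \<epsilon>) * card (X 2)" using assms by (intro mult_left_mono) auto
    moreover have "real (card (X 1)) = 2 - real (card (X 2))" using card by linarith
    ultimately have "\<alpha> \<le> (1 + \<epsilon>) / 2" using le' by (simp add: algebra_simps)
    then show "ennreal \<alpha> \<le> ennreal ((1 + \<epsilon>) / 2)" by (rule ennreal_leI)
  qed
  obtain X where "complete_matching 2 2 X" "EF1 2 a X"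
    using EF1_alpha_ge[of \<epsilon> 2 a] assms market del by auto
  then have "{X. complete_matching 2 2 X \<and> EF1 2 a X} \<noteq> {}" by blast
  moreover have "finite {X. complete_matching 2 2 X \<and> EF1 2 a X}"
    by (rule finite_subset[OF _ finite_complete_matchings[of 2 2]]) auto
  ultimately have "Max (alpha 2 2 a ` {X. complete_matching 2 2 X \<and> EF1 2 a X})
      \<le> ennreal ((1 + \<epsilon>) / 2)"
    using upper by (subst Max_le_iff) auto
  moreover have "frontier_H 2 \<delta> \<le> Max (alpha 2 2 a ` {X. complete_matching 2 2 X \<and> EF1 2 a X})"
    unfolding frontier_H_def using market del assms by (intro INF_lower2[of "(2, a)"]) auto
  ultimately show ?thesis by simp
qed

section \<open>Both bounds combined\<close>

theorem corollary6:
  fixes \<delta> :: real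
  assumes "0 \<le> \<delta>" and "\<delta> \<le> 1"
  shows "frontier_H 2 \<delta> = ennreal ((1 + \<delta>) / 2)"
proof (rule antisym)
  show "frontier_H 2 \<delta> \<le> ennreal ((1 + \<delta>) / 2)"
  proof (rule ennreal_le_epsilon)
    \<comment> \<open>The instance needs \<open>\<epsilon> > 0\<close>: for \<open>\<epsilon> = 0\<close> it has \<open>delta = 1\<close>, hence the limit when \<open>\<delta> = 0\<close>.\<close>
    fix e :: real assume e: "0 < e"
    \<comment> \<open>The cap at 1 meets the condition \<epsilon> \<le> 1 of
      \<open>frontier_H_le\<close> and, as \<delta> \<le> 1, keeps the parameter at least
      \<delta>.\<close>
    have "frontier_H 2 \<delta> \<le> ennreal ((1 + min 1 (\<delta> + e)) / 2)"
      using assms e by (intro frontier_H_le) auto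
    also have "\<dots> \<le> ennreal ((1 + \<delta>) / 2 + e)"
      using assms e by (intro ennreal_leI) (auto simp: min_def field_simps)
    also have "\<dots> = ennreal ((1 + \<delta>) / 2) + ennreal e"
      using assms e by (intro ennreal_plus) auto
    finally show "frontier_H 2 \<delta> \<le> ennreal ((1 + \<delta>) / 2) + ennreal e" .
  qed
next
  show "ennreal ((1 + \<delta>) / 2) \<le> frontier_H 2 \<delta>"
    unfolding frontier_H_def
  proof (rule INF_greatest, clarify)
    fix n a assume "market 2 n a" "\<delta> \<le> delta 2 n a"
    then obtain X where X: "complete_matching 2 n X" "EF1 2 a X"
        "ennreal ((1 + \<delta>) / 2) \<le> alpha 2 n a X"
      using EF1_alpha_ge assms by blast
    have "finite {X. complete_matching 2 n X \<and> EF1 2 a X}"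
      by (rule finite_subset[OF _ finite_complete_matchings[of 2 n]]) auto
    then show "ennreal ((1 + \<delta>) / 2) \<le> Max (alpha 2 n a ` {X. complete_matching 2 n X \<and> EF1 2 a X})"
      using X by (intro order_trans[OF X(3)] Max_ge) auto
  qed
qed

end
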